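(* A mock-Lie algebra $(\mathfrak g,\{\cdot,\cdot\}_{\mathfrak g})$ has a phase space if and only if it is sub-adjacent to a mock-pre-Lie algebra, i.e. if and only if there is a mock-pre-Lie product $\cdot$ on $\mathfrak g$ with $\{x,y\}_{\mathfrak g}=x\cdot y+y\cdot x$ for all $x,y\in\mathfrak g$.
   Context: All vector spaces are finite-dimensional over an algebraically closed field $\mathbb K$ of characteristic $0$; $V^*$ is the dual space and $\langle\cdot,\cdot\rangle$ the natural pairing. A mock-Lie algebra $(\mathfrak g,\{\cdot,\cdot\}_{\mathfrak g})$ is a vector space with a symmetric bilinear map satisfying $\{x,\{y,z\}_{\mathfrak g}\}_{\mathfrak g}+\{y,\{z,x\}_{\mathfrak g}\}_{\mathfrak g}+\{z,\{x,y\}_{\mathfrak g}\}_{\mathfrak g}=0$. A mock-pre-Lie algebra $(\mathfrak g,\cdot)$ is a vector space with a bilinear product satisfying $(x\cdot y)\cdot z+x\cdot(y\cdot z)=-(y\cdot x)\cdot z-y\cdot(x\cdot z)$ for all $x,y,z$. Then $\{x,y\}_c=x\cdot y+y\cdot x$ is a mock-Lie bracket, called the sub-adjacent mock-Lie algebra. A symplectic mock-Lie algebra is a mock-Lie algebra with a nondegenerate skew-symmetric bilinear form $\omega$ satisfying $\omega(\{x,y\},z)+\omega(\{y,z\},x)+\omega(\{z,x\},y)=0$ for all $x,y,z$. Phase space: on $\mathfrak g\oplus\mathfrak g^*$ let $\omega(x+\xi,y+\eta)=\langle\xi,y\rangle-\langle\eta,x\rangle$ for $x,y\in\mathfrak g$,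 $\xi,\eta\in\mathfrak g^*$. A phase space of $(\mathfrak g,\{\cdot,\cdot\}_{\mathfrak g})$ is a symplectic mock-Lie algebra $(\mathfrak g\oplus\mathfrak g^*,\{\cdot,\cdot\},\omega)$, with this $\omega$, such that $(\mathfrak g,\{\cdot,\cdot\}_{\mathfrak g})$ and $(\mathfrak g^*,\{\cdot,\cdot\}|_{\mathfrak g^*})$ are mock-Lie subalgebras of $(\mathfrak g\oplus\mathfrak g^*,\{\cdot,\cdot\})$ (in particular $\{x,y\}=\{x,y\}_{\mathfrak g}$ for $x,y\in\mathfrak g$). *)

theory Defs
  imports
    "HOL-Analysis.Product_Vector"
    "HOL-Library.Function_Algebras"
    "HOL-Computational_Algebra.Polynomial"
begin

text \<open>Algebras live on a subspace \<open>V\<close> of an ambient vector space, since the dual space of an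
  abstract vector space is available only as a subspace of the full function space.\<close>

definition bilinear_on ::
  "('k::field \<Rightarrow> 'a::ab_group_add \<Rightarrow> 'a) \<Rightarrow> ('k \<Rightarrow> 'b::ab_group_add \<Rightarrow> 'b) \<Rightarrow> 'a set \<Rightarrow>
   ('a \<Rightarrow> 'a \<Rightarrow> 'b) \<Rightarrow> bool"
  where "bilinear_on s t V b \<longleftrightarrow>
    (\<forall>x\<in>V. \<forall>y\<in>V. \<forall>z\<in>V. b (x + y) z = b x z + b y z) \<and>
    (\<forall>x\<in>V. \<forall>y\<in>V. \<forall>z\<in>V. b x (y + z) = b x y + b x z) \<and>
    (\<forall>c. \<forall>x\<in>V. \<forall>y\<in>V. b (s c x) y = t c (b x y)) \<and>
    (\<forall>c. \<forall>x\<in>V. \<forall>y\<in>V. b x (s c y) = t c (b x y))"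

locale algebra_on = vector_space s
  for s :: "'k::field \<Rightarrow> 'a::ab_group_add \<Rightarrow> 'a" +
  fixes V :: "'a set" and prd :: "'a \<Rightarrow> 'a \<Rightarrow> 'a"
  assumes subspace_carrier: "subspace V"
    and closed: "x \<in> V \<Longrightarrow> y \<in> V \<Longrightarrow> prd x y \<in> V"
    and bilinear: "bilinear_on s s V prd"

locale mock_Lie_algebra = algebra_on s V br
  for s :: "'k::field \<Rightarrow> 'a::ab_group_add \<Rightarrow> 'a" and V br +
  assumes symmetric: "x \<in> V \<Longrightarrow> y \<in> V \<Longrightarrow> br x y = br y x"
    and jacobi: "x \<in> V \<Longrightarrow> y \<in> V \<Longrightarrow> z \<in> V \<Longrightarrow>
      br x (br y z) + br y (br z x) + br z (br x y) = 0"

locale mock_pre_Lie_algebra = algebra_on s V m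
  for s :: "'k::field \<Rightarrow> 'a::ab_group_add \<Rightarrow> 'a" and V m +
  assumes anti_associator: "x \<in> V \<Longrightarrow> y \<in> V \<Longrightarrow> z \<in> V \<Longrightarrow>
      m (m x y) z + m x (m y z) = - m (m y x) z - m y (m x z)"

locale symplectic_mock_Lie_algebra = mock_Lie_algebra s V br
  for s :: "'k::field \<Rightarrow> 'a::ab_group_add \<Rightarrow> 'a" and V br +
  fixes \<omega> :: "'a \<Rightarrow> 'a \<Rightarrow> 'k"
  assumes form_bilinear: "bilinear_on s (*) V \<omega>"
    and form_skew: "x \<in> V \<Longrightarrow> y \<in> V \<Longrightarrow> \<omega> x y = - \<omega> y x"
    and form_nondegenerate: "x \<in> V \<Longrightarrow> (\<And>y. y \<in> V \<Longrightarrow> \<omega> x y = 0) \<Longrightarrow> x = 0"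
    and form_closed: "x \<in> V \<Longrightarrow> y \<in> V \<Longrightarrow> z \<in> V \<Longrightarrow>
      \<omega> (br x y) z + \<omega> (br y z) x + \<omega> (br z x) y = 0"

definition mock_Lie_subalgebra ::
  "('k::field \<Rightarrow> 'a::ab_group_add \<Rightarrow> 'a) \<Rightarrow> 'a set \<Rightarrow> ('a \<Rightarrow> 'a \<Rightarrow> 'a) \<Rightarrow> 'a set \<Rightarrow> bool"
  where "mock_Lie_subalgebra s V br W \<longleftrightarrow>
    mock_Lie_algebra s V br \<and> W \<subseteq> V \<and> module.subspace s W \<and>
    (\<forall>x\<in>W. \<forall>y\<in>W. br x y \<in> W)"

definition dual_space :: "('k::field \<Rightarrow> 'a::ab_group_add \<Rightarrow> 'a) \<Rightarrow> ('a \<Rightarrow> 'k) set"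
  where "dual_space s = {\<xi>. Vector_Spaces.linear s (*) \<xi>}"

text \<open>Elements of $\mathfrak g \oplus \mathfrak g^*$ are the pairs in \<open>UNIV \<times> dual_space s\<close>;
  functionals are added and scaled pointwise.\<close>

definition phase_scale ::
  "('k::field \<Rightarrow> 'a::ab_group_add \<Rightarrow> 'a) \<Rightarrow> 'k \<Rightarrow> 'a \<times> ('a \<Rightarrow> 'k) \<Rightarrow> 'a \<times> ('a \<Rightarrow> 'k)"
  where "phase_scale s = module_prod.scale s (\<lambda>c \<xi> v. c * \<xi> v)"

definition phase_carrier ::
  "('k::field \<Rightarrow> 'a::ab_group_add \<Rightarrow> 'a) \<Rightarrow> ('a \<times> ('a \<Rightarrow> 'k)) set"
  where "phase_carrier s = UNIV \<times> dual_space s"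

definition phase_form :: "'a \<times> ('a \<Rightarrow> 'k::field) \<Rightarrow> 'a \<times> ('a \<Rightarrow> 'k) \<Rightarrow> 'k"
  where "phase_form u v = snd u (fst v) - snd v (fst u)"

definition is_phase_space ::
  "('k::field \<Rightarrow> 'a::ab_group_add \<Rightarrow> 'a) \<Rightarrow> ('a \<Rightarrow> 'a \<Rightarrow> 'a) \<Rightarrow>
   ('a \<times> ('a \<Rightarrow> 'k) \<Rightarrow> 'a \<times> ('a \<Rightarrow> 'k) \<Rightarrow> 'a \<times> ('a \<Rightarrow> 'k)) \<Rightarrow> bool"
  where "is_phase_space s br B \<longleftrightarrow>
    symplectic_mock_Lie_algebra (phase_scale s) (phase_carrier s) B phase_form \<and>
    mock_Lie_subalgebra (phase_scale s) (phase_carrier s) B (UNIV \<times> {0}) \<and>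
    (\<forall>x y. B (x, 0) (y, 0) = (br x y, 0)) \<and>
    mock_Lie_subalgebra (phase_scale s) (phase_carrier s) B ({0} \<times> dual_space s)"

end

theory Submission
  imports Defs
begin

text \<open>A mock-pre-Lie product with left multiplications \<open>L\<^sub>x\<close> makes \<open>x \<mapsto> (\<xi> \<mapsto> \<xi> \<circ> L\<^sub>x)\<close> a
  representation of the sub-adjacent mock-Lie algebra on the dual space (the anti-associator identity
  says \<open>L\<^bsub>{x,y}\<^esub> = - L\<^sub>x L\<^sub>y - L\<^sub>y L\<^sub>x\<close>, which is stable under transposition without a sign), and the
  semidirect product is a phase space. Conversely, in a phase space the dual component of \<open>{x, \<xi>}\<close>
  is of the form \<open>\<xi> \<circ> L\<^sub>x\<close> by reflexivity; closedness of the form gives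
  \<open>{x, y} = L\<^sub>x y + L\<^sub>y x\<close>, and the Jacobi identity on \<open>x, y, \<xi>\<close> gives the anti-associator identity.\<close>

section \<open>Linear functionals and the direct sum with the dual\<close>

lemma bilinear_onD:
  assumes "bilinear_on s t V b" "x \<in> V" "y \<in> V"
  shows "z \<in> V \<Longrightarrow> b (x + y) z = b x z + b y z"
    and "z \<in> V \<Longrightarrow> b z (x + y) = b z x + b z y"
    and "b (s c x) y = t c (b x y)"
    and "b x (s c y) = t c (b x y)"
  using assms unfolding bilinear_on_def by simp_all

lemma vector_space_functions: "vector_space (\<lambda>(c::'k::field) (\<xi> :: 'a \<Rightarrow> 'k) v. c * \<xi> v)"
  by unfold_locales (auto simp: algebra_simps)

lemma dual_space_iff:
  assumes "vector_space s"
  shows "\<xi> \<in> dual_space s \<longleftrightarrow> (\<forall>x y. \<xi> (x + y) = \<xi> x + \<xi> y) \<and> (\<forall>c x. \<xi> (s c x) = c * \<xi> x)"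
proof -
  have *: "vector_space ((*) :: 'a \<Rightarrow> 'a \<Rightarrow> 'a)"
    by unfold_locales (auto simp: algebra_simps)
  show ?thesis
    using assms * unfolding dual_space_def module_hom_eq_linear[symmetric] module_hom_iff
      module_iff_vector_space by simp
qed

context vector_space
begin

lemma vector_space_phase_scale: "vector_space (phase_scale scale)"
proof -
  interpret F: vector_space "\<lambda>(c::'a) (\<xi> :: 'b \<Rightarrow> 'a) v. c * \<xi> v"
    by (rule vector_space_functions)
  interpret vector_space_prod scale "\<lambda>(c::'a) (\<xi> :: 'b \<Rightarrow> 'a) v. c * \<xi> v" ..
  show ?thesis
    unfolding phase_scale_def by (rule p.vector_space_axioms)
qed

lemma phase_scale_Pair [simp]: "phase_scale scale c (x, \<xi>) = (scale c x, \<lambda>v. c * \<xi> v)"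
proof -
  interpret F: vector_space "\<lambda>(c::'a) (\<xi> :: 'b \<Rightarrow> 'a) v. c * \<xi> v"
    by (rule vector_space_functions)
  interpret vector_space_prod scale "\<lambda>(c::'a) (\<xi> :: 'b \<Rightarrow> 'a) v. c * \<xi> v" ..
  show ?thesis
    unfolding phase_scale_def by (rule scale_prod)
qed

lemma dual_space_simps:
  assumes "\<xi> \<in> dual_space scale"
  shows "\<xi> (x + y) = \<xi> x + \<xi> y" "\<xi> (scale c x) = c * \<xi> x" "\<xi> 0 = 0" "\<xi> (- x) = - \<xi> x"
proof -
  show add: "\<xi> (x + y) = \<xi> x + \<xi> y" and "\<xi> (scale c x) = c * \<xi> x" for x y
    using assms dual_space_iff[OF vector_space_axioms] by auto
  show zero: "\<xi> 0 = 0"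
    using add[of 0 0] by (metis add.right_neutral add_cancel_right_right)
  show "\<xi> (- x) = - \<xi> x"
    using add[of x "- x"] zero by (simp add: eq_neg_iff_add_eq_0 add.commute)
qed

lemma dual_space_closed:
  shows "0 \<in> dual_space scale"
    and "\<xi> \<in> dual_space scale \<Longrightarrow> \<eta> \<in> dual_space scale \<Longrightarrow> \<xi> + \<eta> \<in> dual_space scale"
    and "\<xi> \<in> dual_space scale \<Longrightarrow> (\<lambda>v. c * \<xi> v) \<in> dual_space scale"
  by (auto simp: dual_space_iff[OF vector_space_axioms] algebra_simps)

text \<open>With \<open>W\<close> equal to \<open>UNIV\<close> or \<open>{0}\<close> this covers the
  carrier and both of its summands.\<close>

lemma phase_subspace:
  assumes "subspace W"
  shows "module.subspace (phase_scale scale) (W \<times> {0})"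
    and "module.subspace (phase_scale scale) (W \<times> dual_space scale)"
  using assms dual_space_closed
  by (auto simp: module.subspace_def[OF vector_space_phase_scale[unfolded module_iff_vector_space[symmetric]]] subspace_def
      zero_prod_def zero_fun_def)

end


section \<open>Dual basis and reflexivity\<close>

context finite_dimensional_vector_space
begin

lemma coordinate_in_dual_space: "(\<lambda>x. representation Basis x b) \<in> dual_space scale"
  unfolding dual_space_def mem_Collect_eq
  by (rule linear_representation[OF independent_Basis span_Basis])

lemma sum_coordinates: "(\<Sum>b\<in>Basis. scale (representation Basis x b) b) = x"
  by (rule sum_representation_eq) (auto simp: independent_Basis span_Basis finite_Basis)

text \<open>A vector is determined by its coordinates, which are functionals. Identities between
  vectors can thus be tested after applying each \<xi>.\<close>

lemma dual_space_separates:
  assumes "\<And>\<xi>. \<xi> \<in> dual_space scale \<Longrightarrow> \<xi> x = \<xi> y"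
  shows "x = y"
  by (subst (1 2) sum_coordinates[symmetric]) (simp only: assms[OF coordinate_in_dual_space])

lemma dual_space_sum:
  assumes "\<xi> \<in> dual_space scale"
  shows "\<xi> (\<Sum>b\<in>A. f b) = (\<Sum>b\<in>A. \<xi> (f b))"
  by (induction A rule: infinite_finite_induct) (auto simp: dual_space_simps[OF assms])

text \<open>With the dual basis \<open>c b\<close>, \<xi> is the sum of the \<xi>(b)
  \<open>c b\<close>. Hence \<Phi>(\<xi>) is the sum of the \<xi>(b) \<Phi>(\<open>c b\<close>),
  which is \<xi> applied to the vector with coordinates \<Phi>(\<open>c b\<close>).\<close>

lemma dual_space_reflexive:
  assumes add: "\<And>\<xi> \<eta>. \<xi> \<in> dual_space scale \<Longrightarrow> \<eta> \<in> dual_space scale \<Longrightarrow> \<Phi> (\<xi> + \<eta>) = \<Phi> \<xi> + \<Phi> \<eta>"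
    and scale: "\<And>c \<xi>. \<xi> \<in> dual_space scale \<Longrightarrow> \<Phi> (\<lambda>v. c * \<xi> v) = c * \<Phi> \<xi>"
  shows "\<exists>x. \<forall>\<xi>\<in>dual_space scale. \<Phi> \<xi> = \<xi> x"
proof (intro exI ballI)
  fix \<xi> assume \<xi>: "\<xi> \<in> dual_space scale"
  define c where "c b = (\<lambda>x. representation Basis x b)" for b
  have c: "c b \<in> dual_space scale" for b
    unfolding c_def by (rule coordinate_in_dual_space)
  have "\<Phi> 0 = 0"
    using scale[OF dual_space_closed(1), of 0] by (simp add: zero_fun_def)
  \<comment> \<open>Membership is carried through the induction because \<Phi> is additive only on
    the dual space.\<close>
  then have "(\<Sum>b\<in>A. (\<lambda>v. \<xi> b * c b v)) \<in> dual_space scale \<and>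
      \<Phi> (\<Sum>b\<in>A. (\<lambda>v. \<xi> b * c b v)) = (\<Sum>b\<in>A. \<xi> b * \<Phi> (c b))" for A
    by (induction A rule: infinite_finite_induct)
      (auto simp: add scale c dual_space_closed)
  moreover have "\<xi> x = (\<Sum>b\<in>Basis. (\<lambda>v. \<xi> b * c b v)) x" for x
  proof -
    have "\<xi> x = \<xi> (\<Sum>b\<in>Basis. scale (representation Basis x b) b)"
      by (simp only: sum_coordinates)
    also have "\<dots> = (\<Sum>b\<in>Basis. \<xi> b * c b x)"
      unfolding dual_space_sum[OF \<xi>] dual_space_simps(2)[OF \<xi>] by (simp add: c_def mult.commute)
    also have "\<dots> = (\<Sum>b\<in>A. (\<lambda>v. \<xi> b * c b v)) x" if "A = Basis" for A
      unfolding that[symmetric] by (induction A rule: infinite_finite_induct) auto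
    finally show ?thesis by simp
  qed
  then have "\<xi> = (\<Sum>b\<in>Basis. (\<lambda>v. \<xi> b * c b v))"
    by blast
  ultimately have "\<Phi> \<xi> = (\<Sum>b\<in>Basis. \<xi> b * \<Phi> (c b))"
    by metis
  then show "\<Phi> \<xi> = \<xi> (\<Sum>b\<in>Basis. scale (\<Phi> (c b)) b)"
    unfolding dual_space_sum[OF \<xi>] dual_space_simps(2)[OF \<xi>] by (simp add: mult.commute)
qed

section \<open>From a phase space to a mock-pre-Lie product\<close>

lemma phase_space_imp_mock_pre_Lie:
  assumes "is_phase_space scale br B"
  shows "\<exists>m. mock_pre_Lie_algebra scale UNIV m \<and> (\<forall>x y. br x y = m x y + m y x)"
proof -
  let ?D = "dual_space scale"
  interpret P: symplectic_mock_Lie_algebra "phase_scale scale" "phase_carrier scale" B phase_form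
    using assms unfolding is_phase_space_def by blast
  have B00: "B (x, 0) (y, 0) = (br x y, 0)" for x y
    using assms unfolding is_phase_space_def by blast
  have carrier: "(x, \<xi>) \<in> phase_carrier scale \<longleftrightarrow> \<xi> \<in> ?D" for x \<xi>
    by (simp add: phase_carrier_def)
  have zero_dual: "0 \<in> ?D" and zero_fun: "(\<lambda>v :: 'b. 0 :: 'a) = 0"
    by (auto simp: dual_space_closed fun_eq_iff)
  define T where "T x \<xi> = snd (B (x, 0) (0, \<xi>))" for x \<xi>
  have T_closed: "T x \<xi> \<in> ?D" if "\<xi> \<in> ?D" for x \<xi>
    using P.closed[of "(x, 0)" "(0, \<xi>)"] that unfolding T_def
    by (auto simp: carrier zero_dual phase_carrier_def mem_Times_iff)
  have T_add: "T x (\<xi> + \<eta>) = T x \<xi> + T x \<eta>" if "\<xi> \<in> ?D" "\<eta> \<in> ?D" for x \<xi> \<eta>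
    using bilinear_onD(2)[OF P.bilinear, of "(0, \<xi>)" "(0, \<eta>)" "(x, 0)"] that
    by (simp add: T_def carrier zero_dual)
  have T_scale: "T x (\<lambda>v. c * \<xi> v) = (\<lambda>v. c * T x \<xi> v)" if "\<xi> \<in> ?D" for x c \<xi>
    using bilinear_onD(4)[OF P.bilinear, of "(x, 0)" "(0, \<xi>)" c] that
    by (cases "B (x, 0) (0, \<xi>)") (simp add: T_def carrier zero_dual)
  have T_add_left: "T (x + y) \<xi> = T x \<xi> + T y \<xi>" if "\<xi> \<in> ?D" for x y \<xi>
    using bilinear_onD(1)[OF P.bilinear, of "(x, 0)" "(y, 0)" "(0, \<xi>)"] that
    by (simp add: T_def carrier zero_dual)
  have T_scale_left: "T (scale c x) \<xi> = (\<lambda>v. c * T x \<xi> v)" if "\<xi> \<in> ?D" for x c \<xi>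
    using bilinear_onD(3)[OF P.bilinear, of "(x, 0)" "(0, \<xi>)" c] that
    by (cases "B (x, 0) (0, \<xi>)") (simp add: T_def carrier zero_dual zero_fun)
  \<comment> \<open>The bracket of \<open>(x, 0)\<close> with \<open>(a, 0)\<close> has no dual
    component. So \<open>T x\<close> is the action of \<open>x\<close> on the quotient by the first
    summand, and first components of inner brackets may be dropped.\<close>
  have T_full: "snd (B (x, 0) (a, \<xi>)) = T x \<xi>" if "\<xi> \<in> ?D" for x a \<xi>
    using bilinear_onD(2)[OF P.bilinear, of "(a, 0)" "(0, \<xi>)" "(x, 0)"] that
    by (simp add: T_def carrier zero_dual B00)
  have swap: "B (0, \<xi>) (x, 0) = B (x, 0) (0, \<xi>)" if "\<xi> \<in> ?D" for x \<xi>
    using P.symmetric[of "(0, \<xi>)" "(x, 0)"] that by (simp add: carrier zero_dual)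
  have "\<exists>v. \<forall>\<xi>\<in>?D. T x \<xi> y = \<xi> v" for x y
    by (rule dual_space_reflexive) (simp_all add: T_add T_scale)
  \<comment> \<open>The left multiplication \<open>m x\<close> is the transpose of
    \<open>T x\<close>.\<close>
  then obtain m where m: "\<And>x y \<xi>. \<xi> \<in> ?D \<Longrightarrow> \<xi> (m x y) = T x \<xi> y"
    by metis
  have T_rep: "T (br x y) \<xi> = - T x (T y \<xi>) - T y (T x \<xi>)" if \<xi>: "\<xi> \<in> ?D" for x y \<xi>
  proof -
    have nest: "snd (B (x, 0) (B (y, 0) (0, \<xi>))) = T x (T y \<xi>)" for x y
      using T_full[OF T_closed[OF \<xi>], of x "fst (B (y, 0) (0, \<xi>))" y] by (simp add: T_def)
    have "B (x, 0) (B (y, 0) (0, \<xi>)) + B (y, 0) (B (0, \<xi>) (x, 0)) + B (0, \<xi>) (B (x, 0) (y, 0)) = 0"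
      using P.jacobi[of "(x, 0)" "(y, 0)" "(0, \<xi>)"] \<xi> by (simp add: carrier zero_dual)
    from arg_cong[OF this, of snd] have "T x (T y \<xi>) + T y (T x \<xi>) + T (br x y) \<xi> = 0"
      by (simp add: B00 swap \<xi> nest T_def[symmetric])
    then show ?thesis
      by (metis add.commute diff_conv_add_uminus eq_neg_iff_add_eq_0 minus_add_distrib)
  qed
  have br: "br x y = m x y + m y x" for x y
  proof (rule dual_space_separates)
    fix \<xi> assume \<xi>: "\<xi> \<in> ?D"
    \<comment> \<open>The three terms are -\<xi>(\<open>br x y\<close>), \<xi>(\<open>m y x\<close>)
      and \<xi>(\<open>m x y\<close>).\<close>
    have "phase_form (B (x, 0) (y, 0)) (0, \<xi>) + phase_form (B (y, 0) (0, \<xi>)) (x, 0)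
        + phase_form (B (0, \<xi>) (x, 0)) (y, 0) = 0"
      using P.form_closed[of "(x, 0)" "(y, 0)" "(0, \<xi>)"] \<xi> by (simp add: carrier zero_dual)
    then show "\<xi> (br x y) = \<xi> (m x y + m y x)"
      by (simp add: phase_form_def B00 swap \<xi> T_def[symmetric] m dual_space_simps algebra_simps)
  qed
  have "mock_pre_Lie_algebra scale UNIV m"
  proof
    show "bilinear_on scale scale UNIV m"
      unfolding bilinear_on_def
      \<comment> \<open>Linearity in the first argument comes from that of \<open>T\<close> in
        \<open>x\<close>, in the second from \<open>T x \<xi>\<close> being a functional.\<close>
      by (auto intro!: dual_space_separates
          simp: dual_space_simps m T_add_left T_scale_left dual_space_simps[OF T_closed])
  next
    fix x y z
    show "m (m x y) z + m x (m y z) = - m (m y x) z - m y (m x z)"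
    proof (rule dual_space_separates)
      fix \<xi> assume \<xi>: "\<xi> \<in> ?D"
      have "T (m x y) \<xi> z + T (m y x) \<xi> z = T (br x y) \<xi> z"
        by (simp add: br T_add_left \<xi>)
      \<comment> \<open>Transposition reverses products: \<open>T x (T y \<xi>) z\<close> is
        \<open>T y \<xi> (m x z)\<close>. The sum in \<open>T_rep\<close> is symmetric in
        \<open>x\<close> and \<open>y\<close>, so no sign or order is lost.\<close>
      also have "\<dots> = - T y \<xi> (m x z) - T x \<xi> (m y z)"
        by (simp add: T_rep \<xi> m T_closed)
      finally have "\<xi> (m (m x y) z) + \<xi> (m (m y x) z) = - \<xi> (m y (m x z)) - \<xi> (m x (m y z))"
        by (simp add: m \<xi> T_closed)
      then have "\<xi> (m (m x y) z) + \<xi> (m x (m y z)) = - \<xi> (m (m y x) z) + - \<xi> (m y (m x z))"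
        by algebra
      then show "\<xi> (m (m x y) z + m x (m y z)) = \<xi> (- m (m y x) z - m y (m x z))"
        unfolding diff_conv_add_uminus by (simp only: dual_space_simps[OF \<xi>])
    qed
  qed auto
  with br show ?thesis by blast
qed

section \<open>From a mock-pre-Lie product to a phase space\<close>

lemma mock_pre_Lie_imp_phase_space:
  assumes "mock_Lie_algebra scale UNIV br"
    and "mock_pre_Lie_algebra scale UNIV m"
    and br: "\<And>x y. br x y = m x y + m y x"
  shows "\<exists>B. is_phase_space scale br B"
proof -
  let ?D = "dual_space scale"
  interpret L: mock_Lie_algebra scale UNIV br by fact
  interpret M: mock_pre_Lie_algebra scale UNIV m by fact
  note m_simps = bilinear_onD[OF M.bilinear, simplified]
  note L_simps = bilinear_onD[OF L.bilinear, simplified]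
  \<comment> \<open>The semidirect product: a vector acts on functionals by the transpose of its
    left multiplication, and two functionals have bracket zero.\<close>
  define B where "B u v = (br (fst u) (fst v), \<lambda>w. snd v (m (fst u) w) + snd u (m (fst v) w))"
    for u v :: "'b \<times> ('b \<Rightarrow> 'a)"
  have B: "B (x, \<xi>) (y, \<eta>) = (br x y, \<lambda>w. \<eta> (m x w) + \<xi> (m y w))" for x y \<xi> \<eta>
    by (simp add: B_def)
  have dual: "(\<lambda>w. \<eta> (m x w) + \<xi> (m y w)) \<in> ?D" if "\<xi> \<in> ?D" "\<eta> \<in> ?D" for x y \<xi> \<eta>
    using that by (simp add: dual_space_iff[OF vector_space_axioms] m_simps algebra_simps)
  have m_rep: "\<xi> (m (br x y) w) = - \<xi> (m x (m y w)) - \<xi> (m y (m x w))" if "\<xi> \<in> ?D" for x y w \<xi>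
  proof -
    have "m (br x y) w = (m (m x y) w + m x (m y w)) + m (m y x) w - m x (m y w)"
      by (simp add: br m_simps)
    also have "\<dots> = - m x (m y w) + - m y (m x w)"
      unfolding M.anti_associator[OF UNIV_I UNIV_I UNIV_I] by simp
    finally have "m (br x y) w = - m x (m y w) + - m y (m x w)" .
    then show ?thesis
      using that by (simp only: dual_space_simps) simp
  qed
  have bil: "bilinear_on (phase_scale scale) (phase_scale scale) (phase_carrier scale) B"
    by (auto simp: bilinear_on_def phase_carrier_def B L_simps m_simps dual_space_simps fun_eq_iff
        algebra_simps)
  have sub: "module.subspace (phase_scale scale) (phase_carrier scale)"
    unfolding phase_carrier_def by (rule phase_subspace) simp
  interpret A: algebra_on "phase_scale scale" "phase_carrier scale" B
    using vector_space_phase_scale sub bil dual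
    by (auto simp: algebra_on_def algebra_on_axioms_def phase_carrier_def B)
  interpret P: mock_Lie_algebra "phase_scale scale" "phase_carrier scale" B
  proof
    fix u v w
    assume "u \<in> phase_carrier scale" "v \<in> phase_carrier scale" "w \<in> phase_carrier scale"
    \<comment> \<open>In the dual component of the Jacobi sum, the terms containing any one of the
      three functionals cancel by \<open>m_rep\<close>.\<close>
    then show "B u v = B v u" "B u (B v w) + B v (B w u) + B w (B u v) = 0"
      using L.symmetric L.jacobi
      by (auto simp: phase_carrier_def B fun_eq_iff m_rep zero_prod_def add.commute)
  qed
  have "symplectic_mock_Lie_algebra (phase_scale scale) (phase_carrier scale) B phase_form"
  proof
    show "bilinear_on (phase_scale scale) (*) (phase_carrier scale) phase_form"
      by (auto simp: bilinear_on_def phase_carrier_def phase_form_def dual_space_simps algebra_simps)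
  next
    fix u v w
    assume u: "u \<in> phase_carrier scale"
    {
      assume nondeg: "\<And>v. v \<in> phase_carrier scale \<Longrightarrow> phase_form u v = 0"
      obtain x \<xi> where u_eq: "u = (x, \<xi>)" and \<xi>: "\<xi> \<in> ?D"
        using u by (auto simp: phase_carrier_def)
      \<comment> \<open>Pairing with vectors kills \<xi>; pairing with functionals then kills
        \<open>x\<close>.\<close>
      have "\<xi> = 0"
        using nondeg[of "(_, 0)"] by (auto simp: u_eq phase_carrier_def phase_form_def dual_space_closed)
      moreover have "x = 0"
      proof (rule dual_space_separates)
        fix \<eta> assume "\<eta> \<in> ?D"
        then show "\<eta> x = \<eta> 0"
          using nondeg[of "(0, \<eta>)"] \<xi> by (simp add: u_eq phase_carrier_def phase_form_def dual_space_simps)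
      qed
      ultimately show "u = 0"
        by (simp add: u_eq zero_prod_def)
    }
    assume v: "v \<in> phase_carrier scale"
    show "phase_form u v = - phase_form v u"
      by (simp add: phase_form_def)
    assume w: "w \<in> phase_carrier scale"
    show "phase_form (B u v) w + phase_form (B v w) u + phase_form (B w u) v = 0"
      using u v w
      \<comment> \<open>Collecting the terms of each functional, say \<zeta> of \<open>w\<close>,
        leaves \<zeta>(\<open>m x y + m y x - br x y\<close>), where \<open>x\<close> and
        \<open>y\<close> are the vectors of \<open>u\<close> and \<open>v\<close>.\<close>
      by (auto simp: phase_carrier_def phase_form_def B br dual_space_simps algebra_simps)
  qed
  moreover have "mock_Lie_subalgebra (phase_scale scale) (phase_carrier scale) B (UNIV \<times> {0})"
    using phase_subspace(1)[of UNIV] P.mock_Lie_algebra_axioms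
    by (auto simp: mock_Lie_subalgebra_def phase_carrier_def B zero_fun_def
        dual_space_closed(1)[unfolded zero_fun_def])
  moreover have "mock_Lie_subalgebra (phase_scale scale) (phase_carrier scale) B ({0} \<times> ?D)"
    \<comment> \<open>The instance of \<open>L_simps(3)\<close> gives \<open>br 0 0 = 0\<close>, so
      brackets of functionals have first component zero.\<close>
    using phase_subspace(2)[of "{0}"] P.mock_Lie_algebra_axioms L_simps(3)[of 0 0 0] dual
    by (auto simp: mock_Lie_subalgebra_def phase_carrier_def B)
  moreover have "B (x, 0) (y, 0) = (br x y, 0)" for x y
    by (simp add: B zero_fun_def)
  ultimately show ?thesis
    unfolding is_phase_space_def by blast
qed

end

theorem theorem2p21:
  fixes s :: "'k::{alg_closed_field, field_char_0} \<Rightarrow> 'v::ab_group_add \<Rightarrow> 'v"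
    and Basis :: "'v set"
    and br :: "'v \<Rightarrow> 'v \<Rightarrow> 'v"
  assumes "finite_dimensional_vector_space s Basis"
    and "mock_Lie_algebra s UNIV br"
  shows "(\<exists>B. is_phase_space s br B) \<longleftrightarrow>
    (\<exists>m. mock_pre_Lie_algebra s UNIV m \<and> (\<forall>x y. br x y = m x y + m y x))"
  using finite_dimensional_vector_space.phase_space_imp_mock_pre_Lie[OF assms(1)]
    finite_dimensional_vector_space.mock_pre_Lie_imp_phase_space[OF assms]
  by blast

end
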